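(* For every integer $n\ge 0$, $$|RAI_{2n}(4321)|=M_n,$$ where $M_n$ is the $n$-th Motzkin number.
   Context: Let $S_n$ be the set of permutations $\pi=\pi_1\ldots\pi_n$ of $\{1,\ldots,n\}$ (for $n=0$, only the empty permutation). A permutation is reverse alternating if, for all $1\le i\le n-1$, $\pi_i>\pi_{i+1}$ if and only if $i$ is odd. $RAI_n$ is the set of reverse alternating involutions ($\pi=\pi^{-1}$) in $S_n$. A permutation $\pi\in S_n$ avoids the pattern $\tau\in S_k$ if there are no indices $i_1<\cdots<i_k$ such that $\pi_{i_1}\ldots\pi_{i_k}$ is order-isomorphic to $\tau$; $RAI_n(\tau)$ is the set of elements of $RAI_n$ avoiding $\tau$. The Motzkin number $M_n$ is the number of Motzkin paths of length $n$, i.e. lattice paths from $(0,0)$ to $(n,0)$ with steps $U=(1,1)$, $D=(1,-1)$, $H=(1,0)$ that stay weakly above the $x$-axis (so $M_0=M_1=1$, $M_2=2$, $M_3=4$). *)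

theory Defs
  imports "HOL-Combinatorics.Permutations"
begin

text \<open>
  A permutation \<open>\<pi> = \<pi>\<^sub>1 \<dots> \<pi>\<^sub>n\<close> of \<open>{1, \<dots>, n}\<close> is a function with \<open>\<pi> permutes {1..n}\<close>, where
  \<open>\<pi>\<^sub>i = \<pi> i\<close>. It fixes everything outside \<open>{1..n}\<close>, so each permutation is represented exactly
  once and \<open>inv\<close> on functions is the inverse in \<open>S\<^sub>n\<close>.
\<close>

definition S :: "nat \<Rightarrow> (nat \<Rightarrow> nat) set" where
  "S n = {\<pi>. \<pi> permutes {1..n}}"

definition reverse_alternating :: "nat \<Rightarrow> (nat \<Rightarrow> nat) \<Rightarrow> bool" where
  "reverse_alternating n \<pi> \<longleftrightarrow> (\<forall>i. 1 \<le> i \<and> i + 1 \<le> n \<longrightarrow> (\<pi> i > \<pi> (i + 1) \<longleftrightarrow> odd i))"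

definition RAI :: "nat \<Rightarrow> (nat \<Rightarrow> nat) set" where
  "RAI n = {\<pi> \<in> S n. reverse_alternating n \<pi> \<and> \<pi> = inv \<pi>}"

text \<open>
  Here \<open>\<pi>\<close> is in \<open>S\<^sub>n\<close> and \<open>\<tau>\<close> is in \<open>S\<^sub>k\<close>; the function \<open>f\<close> lists the positions
  \<open>f 1 < \<dots> < f k\<close> of an occurrence of \<open>\<tau>\<close> in \<open>\<pi>\<close>.
\<close>

definition contains_pattern :: "nat \<Rightarrow> (nat \<Rightarrow> nat) \<Rightarrow> nat \<Rightarrow> (nat \<Rightarrow> nat) \<Rightarrow> bool" where
  "contains_pattern n \<pi> k \<tau> \<longleftrightarrow>
     (\<exists>f :: nat \<Rightarrow> nat. strict_mono_on {1..k} f \<and> f ` {1..k} \<subseteq> {1..n} \<and>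
        (\<forall>a\<in>{1..k}. \<forall>b\<in>{1..k}. \<pi> (f a) < \<pi> (f b) \<longleftrightarrow> \<tau> a < \<tau> b))"

definition RAI_avoiding :: "nat \<Rightarrow> nat \<Rightarrow> (nat \<Rightarrow> nat) \<Rightarrow> (nat \<Rightarrow> nat) set" where
  "RAI_avoiding n k \<tau> = {\<pi> \<in> RAI n. \<not> contains_pattern n \<pi> k \<tau>}"

text \<open>The permutation with the given one-line notation, for instance \<open>one_line [4, 3, 2, 1]\<close>.\<close>

definition one_line :: "nat list \<Rightarrow> nat \<Rightarrow> nat" where
  "one_line w i = (if i \<in> {1..length w} then w ! (i - 1) else i)"

lemma one_line_4321: "one_line [4, 3, 2, 1] \<in> S 4"
proof -
  have *: "{1..4::nat} = {1, 2, 3, 4}" by auto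
  have "bij_betw (one_line [4, 3, 2, 1]) {1..4} {1..4}"
    unfolding bij_betw_def * by (auto simp: inj_on_def one_line_def)
  then have "one_line [4, 3, 2, 1] permutes {1..4}"
    by (rule bij_imp_permutes) (auto simp: one_line_def)
  then show ?thesis by (simp add: S_def)
qed

datatype step = Up | Down | Flat

fun rise :: "step \<Rightarrow> int" where
  "rise Up = 1"
| "rise Down = -1"
| "rise Flat = 0"

text \<open>
  All steps have horizontal extent 1, so a path from the origin is determined by its list of steps,
  and after \<open>i\<close> steps it is at \<open>(i, height (take i w))\<close>.
\<close>

definition height :: "step list \<Rightarrow> int" where
  "height w = sum_list (map rise w)"

definition motzkin_paths :: "nat \<Rightarrow> step list set" where
  "motzkin_paths n =
     {w. length w = n \<and> height w = 0 \<and> (\<forall>i\<le>n. 0 \<le> height (take i w))}"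

definition motzkin :: "nat \<Rightarrow> nat" where
  "motzkin n = card (motzkin_paths n)"

end

theory Submission
  imports Defs "HOL-Library.Infinite_Set"
begin

text \<open>
  View an involution as a set of arcs \<open>{i, \<pi> i}\<close> together with fixed points. It avoids 4321 iff no
  arc is nested in another, that is, iff \<open>\<pi>\<close> is increasing on the left ends of arcs; then \<open>\<pi>\<close> is
  determined by the set \<open>A\<close> of left ends and the set \<open>B\<close> of right ends, and a pair \<open>(A, B)\<close> occurs
  iff it satisfies the ballot condition. Ordering the three kinds of points as left end < fixed
  point < right end, a descent of \<open>\<pi>\<close> is a strict increase of kind. Hence \<open>\<pi>\<close> is reverse
  alternating of length \<open>2n\<close> iff each pair of positions \<open>2k + 1, 2k + 2\<close> is of the kind (left end,
  fixed point), (left end, right end) or (fixed point, right end). Reading these as up, flat and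
  down steps gives a Motzkin path of length \<open>n\<close>.
\<close>

section \<open>Left and right ends of the arcs of an involution\<close>

definition openers :: "(nat \<Rightarrow> nat) \<Rightarrow> nat set" where
  "openers \<pi> = {i. i < \<pi> i}"

definition closers :: "(nat \<Rightarrow> nat) \<Rightarrow> nat set" where
  "closers \<pi> = {i. \<pi> i < i}"

lemma inv_eq_self_iff: "bij \<pi> \<Longrightarrow> \<pi> = inv \<pi> \<longleftrightarrow> (\<forall>i. \<pi> (\<pi> i) = i)"
  by (metis bij_inv_eq_iff ext)

lemma RAI_iff:
  "\<pi> \<in> RAI m \<longleftrightarrow> \<pi> permutes {1..m} \<and> (\<forall>i. \<pi> (\<pi> i) = i) \<and> reverse_alternating m \<pi>"
  unfolding RAI_def S_def using inv_eq_self_iff permutes_bij by blast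

lemma permutes_openers_closers_subset:
  assumes "\<pi> permutes D"
  shows "openers \<pi> \<subseteq> D" "closers \<pi> \<subseteq> D"
  using permutes_not_in[OF assms] by (force simp: openers_def closers_def)+

lemma involution_image_openers:
  assumes "\<And>i. \<pi> (\<pi> i) = i"
  shows "\<pi> ` openers \<pi> = closers \<pi>"
  unfolding openers_def closers_def by (auto simp: assms image_iff intro!: exI[of _ "\<pi> _"])

section \<open>Avoiding 4321 and nested arcs\<close>

lemma contains_4321_iff:
  "contains_pattern m \<pi> 4 (one_line [4, 3, 2, 1]) \<longleftrightarrow>
    (\<exists>a b c d. 1 \<le> a \<and> a < b \<and> b < c \<and> c < d \<and> d \<le> m \<and>
       \<pi> d < \<pi> c \<and> \<pi> c < \<pi> b \<and> \<pi> b < \<pi> a)"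
    (is "_ \<longleftrightarrow> ?R")
proof -
  have four: "{1..4::nat} = {1, 2, 3, 4}" by auto
  show ?thesis
  proof
    assume "contains_pattern m \<pi> 4 (one_line [4, 3, 2, 1])"
    then obtain f where f: "strict_mono_on {1..4} f" "f ` {1..4} \<subseteq> {1..m}"
      "\<forall>a\<in>{1..4}. \<forall>b\<in>{1..4}.
         \<pi> (f a) < \<pi> (f b) \<longleftrightarrow> one_line [4, 3, 2, 1] a < one_line [4, 3, 2, 1] b"
      unfolding contains_pattern_def by blast
    have "f 1 < f 2" "f 2 < f 3" "f 3 < f 4"
      by (intro strict_mono_onD[OF f(1)]; simp)+
    moreover have "1 \<le> f 1" "f 4 \<le> m"
      using image_subset_iff[THEN iffD1, OF f(2), rule_format, of 1]
        image_subset_iff[THEN iffD1, OF f(2), rule_format, of 4] by simp_all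
    moreover have "\<pi> (f 4) < \<pi> (f 3)" "\<pi> (f 3) < \<pi> (f 2)" "\<pi> (f 2) < \<pi> (f 1)"
      using f(3) by (simp_all add: one_line_def)
    ultimately show ?R by blast
  next
    assume ?R
    then obtain a b c d where "1 \<le> a" "a < b" "b < c" "c < d" "d \<le> m"
      "\<pi> d < \<pi> c" "\<pi> c < \<pi> b" "\<pi> b < \<pi> a" by blast
    then show "contains_pattern m \<pi> 4 (one_line [4, 3, 2, 1])"
      unfolding contains_pattern_def four
      by (intro exI[of _ "one_line [a, b, c, d]"])
        (auto simp: one_line_def strict_mono_on_def)
  qed
qed

text \<open>Nested arcs \<open>a < b < \<pi> b < \<pi> a\<close> are themselves an occurrence of
  4321, read at these four positions. Conversely, either the first two or the last two entries of an
  occurrence belong to nested arcs.\<close>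

lemma involution_avoids_4321_iff:
  assumes perm: "\<pi> permutes {1..m}" and invol: "\<And>i. \<pi> (\<pi> i) = i"
  shows "\<not> contains_pattern m \<pi> 4 (one_line [4, 3, 2, 1]) \<longleftrightarrow> strict_mono_on (openers \<pi>) \<pi>"
proof
  assume avoid: "\<not> contains_pattern m \<pi> 4 (one_line [4, 3, 2, 1])"
  show "strict_mono_on (openers \<pi>) \<pi>"
  proof (rule strict_mono_onI, rule ccontr)
    fix a b assume ab: "a \<in> openers \<pi>" "b \<in> openers \<pi>" "a < b" "\<not> \<pi> a < \<pi> b"
    have "\<pi> a \<noteq> \<pi> b"
      using ab(3) invol by (metis less_irrefl)
    then have "a < b" "b < \<pi> b" "\<pi> b < \<pi> a"
      using ab by (auto simp: openers_def)
    moreover have "a \<in> {1..m}"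
      using ab permutes_openers_closers_subset[OF perm] by blast
    then have "1 \<le> a" "\<pi> a \<le> m"
      using permutes_in_image[OF perm, of a] by auto
    ultimately show False
      using avoid invol unfolding contains_4321_iff by metis
  qed
next
  assume mono: "strict_mono_on (openers \<pi>) \<pi>"
  show "\<not> contains_pattern m \<pi> 4 (one_line [4, 3, 2, 1])"
    unfolding contains_4321_iff
  proof clarify
    fix a b c d
    assume *: "a < b" "b < c" "c < d" "\<pi> d < \<pi> c" "\<pi> c < \<pi> b" "\<pi> b < \<pi> a"
    show False
    \<comment> \<open>If \<open>b\<close> is a left end, the arcs starting at \<open>a\<close> and
      \<open>b\<close> are nested. Otherwise \<open>\<pi> c < \<pi> b \<le> b < c\<close>, so
      \<open>c\<close> and \<open>d\<close> are right ends and the arcs ending there are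
      nested.\<close>
    proof (cases "b < \<pi> b")
      case True
      then show False
        using * strict_mono_onD[OF mono, of a b] by (simp add: openers_def)
    next
      case False
      then show False
        using * strict_mono_onD[OF mono, of "\<pi> d" "\<pi> c"] by (simp add: openers_def invol)
    qed
  qed
qed

section \<open>Descents and the kinds of neighbouring points\<close>

lemma nonnesting_descent_iff:
  assumes invol: "\<And>i. \<pi> (\<pi> i) = i" and mono: "strict_mono_on (openers \<pi>) \<pi>"
  shows "\<pi> (i + 1) < \<pi> i \<longleftrightarrow>
    i \<in> openers \<pi> \<and> i + 1 \<notin> openers \<pi> \<or> i \<notin> closers \<pi> \<and> i + 1 \<in> closers \<pi>"
proof -
  have ne: "\<pi> (i + 1) \<noteq> \<pi> i"
    using invol by (metis n_not_Suc_n Suc_eq_plus1)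
  \<comment> \<open>For a left end \<open>i\<close> before a fixed point, this sharpens
    \<open>\<pi> i > i\<close> to \<open>\<pi> i > i + 1\<close>, a descent.\<close>
  have fixed: "\<pi> i \<noteq> i + 1" if "\<pi> (i + 1) = i + 1"
    using that ne by auto
  have up: "\<pi> i < \<pi> (i + 1)" if "i < \<pi> i" "i + 1 < \<pi> (i + 1)"
    using that strict_mono_onD[OF mono, of i "i + 1"] by (simp add: openers_def)
  \<comment> \<open>\<open>\<pi>\<close> maps right ends back to left ends, so monotonicity on left
    ends carries over to right ends.\<close>
  have down: "\<pi> i < \<pi> (i + 1)" if "\<pi> i < i" "\<pi> (i + 1) < i + 1"
    using that ne strict_mono_onD[OF mono, of "\<pi> (i + 1)" "\<pi> i"]
    by (auto simp: openers_def invol neq_iff)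
  show ?thesis
    using ne fixed up down by (auto simp: openers_def closers_def)
qed

text \<open>The right-hand side says that the kind rises strictly within each pair, which encodes
  the descents at odd positions. The absence of descents at even positions then comes for
  free.\<close>

lemma nonnesting_reverse_alternating_iff:
  assumes perm: "\<pi> permutes {1..2 * n}"
    and invol: "\<And>i. \<pi> (\<pi> i) = i" and mono: "strict_mono_on (openers \<pi>) \<pi>"
  shows "reverse_alternating (2 * n) \<pi> \<longleftrightarrow>
    (\<forall>k<n. 2 * k + 1 \<notin> closers \<pi> \<and> 2 * k + 2 \<notin> openers \<pi> \<and>
       (2 * k + 1 \<in> openers \<pi> \<or> 2 * k + 2 \<in> closers \<pi>))"
    (is "_ \<longleftrightarrow> ?R")
proof
  assume alt: "reverse_alternating (2 * n) \<pi>"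
  show ?R
  proof (intro allI impI)
    fix k assume "k < n"
    then have "\<pi> (2 * k + 1 + 1) < \<pi> (2 * k + 1)"
      using alt unfolding reverse_alternating_def by auto
    then show "2 * k + 1 \<notin> closers \<pi> \<and> 2 * k + 2 \<notin> openers \<pi> \<and>
       (2 * k + 1 \<in> openers \<pi> \<or> 2 * k + 2 \<in> closers \<pi>)"
      unfolding nonnesting_descent_iff[OF invol mono] by (auto simp: openers_def closers_def)
  qed
next
  assume R: ?R
  show "reverse_alternating (2 * n) \<pi>"
    unfolding reverse_alternating_def
  proof (intro allI impI)
    fix i assume i: "1 \<le> i \<and> i + 1 \<le> 2 * n"
    show "\<pi> i > \<pi> (i + 1) \<longleftrightarrow> odd i"
    proof (cases "odd i")
      case True
      then obtain k where k: "i = 2 * k + 1" by (elim oddE)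
      then have "k < n" using i by simp
      then show ?thesis
        using R True unfolding nonnesting_descent_iff[OF invol mono] k by auto
    next
      case False
      then obtain k where k: "i = 2 * k + 2"
        using i by (metis One_nat_def Suc_eq_plus1 add.commute add_2_eq_Suc evenE mult_Suc_right
          not0_implies_Suc not_one_le_zero mult_0_right)
      then have "k < n" "k + 1 < n" using i by simp_all
      \<comment> \<open>\<open>i\<close> is the second point of pair \<open>k\<close> and
        \<open>i + 1\<close> the first point of pair \<open>k + 1\<close>, so the kind cannot rise
        between them.\<close>
      then have "i \<notin> openers \<pi>" "i + 1 \<notin> closers \<pi>"
        using R[rule_format, of k] R[rule_format, of "k + 1"] by (auto simp: k)
      then show ?thesis
        using False unfolding nonnesting_descent_iff[OF invol mono] by simp
    qed
  qed
qed

section \<open>Uniqueness of a nonnesting involution with given ends\<close>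

lemma strict_mono_on_eq_of_same_image:
  fixes f g :: "'a :: wellorder \<Rightarrow> 'b :: linorder"
  assumes f: "strict_mono_on A f" and g: "strict_mono_on A g" and im: "f ` A = g ` A"
    and "a \<in> A"
  shows "f a = g a"
  using \<open>a \<in> A\<close>
proof (induction a rule: less_induct)
  case (less a)
  have "f a \<in> g ` A" "g a \<in> f ` A"
    using im less.prems by blast+
  then obtain b c where b: "b \<in> A" "f a = g b" and c: "c \<in> A" "g a = f c"
    by blast
  \<comment> \<open>If \<open>b < a\<close>, induction gives \<open>f b = g b = f a\<close>, against
    strict monotonicity of \<open>f\<close>; symmetrically for \<open>c\<close>. What remains is the
    cycle \<open>g a \<le> g b = f a \<le> f c = g a\<close>.\<close>
  have "\<not> b < a"
    using less.IH[of b] b less.prems strict_mono_onD[OF f, of b a] by auto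
  moreover have "\<not> c < a"
    using less.IH[of c] c less.prems strict_mono_onD[OF g, of c a] by auto
  ultimately have "a \<le> b" "a \<le> c"
    by simp_all
  then have "g a \<le> g b" "f a \<le> f c"
    using b(1) c(1) less.prems strict_mono_on_leD[OF f] strict_mono_on_leD[OF g] by blast+
  then show ?case
    by (simp add: b(2)[symmetric] c(2)[symmetric])
qed

text \<open>On left ends both maps are the increasing bijection onto the right ends; on right ends
  they agree as the inverses of these bijections; all other points are fixed by both.\<close>

lemma nonnesting_involution_unique:
  assumes \<pi>: "\<And>i. \<pi> (\<pi> i) = i" "strict_mono_on (openers \<pi>) \<pi>"
    and \<rho>: "\<And>i. \<rho> (\<rho> i) = i" "strict_mono_on (openers \<rho>) \<rho>"
    and eq: "openers \<pi> = openers \<rho>" "closers \<pi> = closers \<rho>"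
  shows "\<pi> = \<rho>"
proof
  have *: "\<pi> i = \<rho> i" if "i \<in> openers \<pi>" for i
    using strict_mono_on_eq_of_same_image[of "openers \<pi>" \<pi> \<rho> i] that \<pi>(2) \<rho>(2) eq
      involution_image_openers[of \<pi>] involution_image_openers[of \<rho>] \<pi>(1) \<rho>(1) by simp
  fix i
  consider "i \<in> openers \<pi>" | "i \<in> closers \<pi>" | "i \<notin> openers \<pi>" "i \<notin> closers \<pi>" by blast
  then show "\<pi> i = \<rho> i"
  proof cases
    case 1
    then show ?thesis by (rule *)
  next
    case 2
    then obtain j where "j \<in> openers \<pi>" "i = \<pi> j"
      using involution_image_openers[of \<pi>] \<pi>(1) by blast
    then show ?thesis using *[of j] \<pi>(1) \<rho>(1) by metis
  next
    case 3
    moreover from this have "i \<notin> openers \<rho>" "i \<notin> closers \<rho>" using eq by simp_all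
    ultimately show ?thesis by (simp add: openers_def closers_def)
  qed
qed

section \<open>The ballot condition and existence of a nonnesting involution\<close>

lemma involution_ballot:
  assumes "\<And>i. \<pi> (\<pi> i) = i" "finite (openers \<pi>)"
  shows "card (closers \<pi> \<inter> {..i}) \<le> card (openers \<pi> \<inter> {..i})"
proof (rule card_inj_on_le)
  show "inj_on \<pi> (closers \<pi> \<inter> {..i})"
    using assms(1) by (metis inj_onI)
  \<comment> \<open>A right end goes to its left end, which is smaller, so the bound
    \<open>i\<close> is kept.\<close>
  show "\<pi> ` (closers \<pi> \<inter> {..i}) \<subseteq> openers \<pi> \<inter> {..i}"
    using assms(1) by (auto simp: openers_def closers_def)
qed (use assms in simp)

lemma involution_card_closers:
  assumes "\<And>i. \<pi> (\<pi> i) = i"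
  shows "card (closers \<pi>) = card (openers \<pi>)"
proof -
  have "inj_on \<pi> (openers \<pi>)" using assms by (metis inj_onI)
  then show ?thesis using involution_image_openers[of \<pi>] assms by (metis card_image)
qed

lemma ex_strict_mono_bij:
  fixes A B :: "'a :: wellorder set"
  assumes "finite A" "finite B" "card A = card B"
  obtains f where "bij_betw f A B" "strict_mono_on A f"
proof -
  obtain g where g: "bij_betw g {..<card A} A" "strict_mono_on {..<card A} g"
    using ex_bij_betw_strict_mono_card[OF assms(1)] .
  obtain h where h: "bij_betw h {..<card A} B" "strict_mono_on {..<card A} h"
    using ex_bij_betw_strict_mono_card[OF assms(2)] assms(3) by metis
  \<comment> \<open>Take each element of \<open>A\<close> to its rank, then to the element of
    \<open>B\<close> of the same rank.\<close>
  define f where "f = h \<circ> the_inv_into {..<card A} g"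
  have f: "f (g i) = h i" if "i < card A" for i
    using that g(1) by (simp add: f_def bij_betw_def the_inv_into_f_f)
  show thesis
  proof
    show "bij_betw f A B"
      unfolding f_def by (rule bij_betw_trans[OF bij_betw_the_inv_into[OF g(1)] h(1)])
    show "strict_mono_on A f"
    proof (rule strict_mono_onI)
      fix x y assume "x \<in> A" "y \<in> A" "x < y"
      then obtain i j where ij: "i < card A" "x = g i" "j < card A" "y = g j"
        using bij_betw_imp_surj_on[OF g(1)] by blast
      have "i < j"
        using \<open>x < y\<close> ij strict_mono_onD[OF g(2), of j i]
        by (cases i j rule: linorder_cases) auto
      then show "f x < f y"
        using ij f strict_mono_onD[OF h(2), of i j] by simp
    qed
  qed
qed

text \<open>Join the elements of \<open>A\<close> and \<open>B\<close> of equal rank by arcs. The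
  ballot condition ensures that each arc starts at its element of \<open>A\<close>.\<close>

lemma ex_nonnesting_involution:
  fixes A B :: "nat set"
  assumes fin: "finite A" "finite B" and disj: "A \<inter> B = {}" and card: "card A = card B"
    and ballot: "\<And>i. card (B \<inter> {..i}) \<le> card (A \<inter> {..i})"
  obtains \<pi> where "\<pi> permutes A \<union> B" "\<And>i. \<pi> (\<pi> i) = i" "openers \<pi> = A" "closers \<pi> = B"
    "strict_mono_on A \<pi>"
proof -
  obtain f where f: "bij_betw f A B" and mono: "strict_mono_on A f"
    using ex_strict_mono_bij fin card by metis
  define g where "g = the_inv_into A f"
  have fB: "f a \<in> B" if "a \<in> A" for a
    using that f bij_betwE by blast
  have gA: "g b \<in> A" if "b \<in> B" for b
    using that f bij_betwE bij_betw_the_inv_into unfolding g_def by blast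
  have gf: "g (f a) = a" if "a \<in> A" for a
    using that f unfolding g_def by (meson bij_betw_imp_inj_on the_inv_into_f_f)
  have fg: "f (g b) = b" if "b \<in> B" for b
    using that f unfolding g_def by (meson f_the_inv_into_f_bij_betw)
  have less: "a < f a" if a: "a \<in> A" for a
  proof (rule ccontr)
    assume "\<not> a < f a"
    then have "f a < a"
      using a fB disj by (metis IntI emptyE linorder_neqE)
    have inj: "inj_on f A"
      using f by (rule bij_betw_imp_inj_on)
    \<comment> \<open>With \<open>f a < a\<close>, the bound \<open>f a\<close> cuts off
      \<open>a\<close> itself, while \<open>f\<close> sends all of \<open>A \<inter> {..a}\<close>
      below or to \<open>f a\<close>. So more points of \<open>B\<close> than of \<open>A\<close>
      lie up to \<open>f a\<close>, contradicting the ballot condition there.\<close>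
    have "card (A \<inter> {..f a}) < card (A \<inter> {..a})"
    proof (rule psubset_card_mono)
      have "a \<in> A \<inter> {..a}" "a \<notin> A \<inter> {..f a}" "A \<inter> {..f a} \<subseteq> A \<inter> {..a}"
        using a \<open>f a < a\<close> by auto
      then show "A \<inter> {..f a} \<subset> A \<inter> {..a}"
        by blast
    qed (use fin in simp)
    also have "\<dots> = card (f ` (A \<inter> {..a}))"
      using inj by (metis card_image inf_le1 inj_on_subset)
    also have "\<dots> \<le> card (B \<inter> {..f a})"
      using a fin fB strict_mono_onD[OF mono, of _ a]
      by (intro card_mono) (auto simp: order_le_less)
    finally show False
      using ballot[of "f a"] by simp
  qed
  define \<pi> where "\<pi> i = (if i \<in> A then f i else if i \<in> B then g i else i)" for i
  have invol: "\<pi> (\<pi> i) = i" for i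
    using disj by (auto simp: \<pi>_def fB gA gf fg dest: fB gA)
  have greater: "g b < b" if "b \<in> B" for b
    using less[of "g b"] that by (simp add: gA fg)
  show thesis
  proof
    show "\<pi> permutes A \<union> B"
      unfolding permutes_def using invol by (metis UnI1 UnI2 \<pi>_def)
    show "openers \<pi> = A" "closers \<pi> = B"
      using less greater disj
      by (auto simp: openers_def closers_def \<pi>_def split: if_splits dest: less_asym)
    show "strict_mono_on A \<pi>"
      using mono by (simp add: strict_mono_on_def \<pi>_def)
  qed (rule invol)
qed

section \<open>Motzkin paths as pairs of marked sets\<close>

text \<open>The intended left ends; \<open>even_marks\<close> gives the right ends. The zero-based
  step \<open>k\<close> describes positions \<open>2 * k + 1\<close> and \<open>2 * k + 2\<close>:
  \<open>Up\<close> is left end, fixed point; \<open>Flat\<close> is left end, right end;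
  \<open>Down\<close> is fixed point, right end.\<close>

definition odd_marks :: "step list \<Rightarrow> nat set" where
  "odd_marks w = (\<lambda>k. 2 * k + 1) ` {k. k < length w \<and> w ! k \<noteq> Down}"

definition even_marks :: "step list \<Rightarrow> nat set" where
  "even_marks w = (\<lambda>k. 2 * k + 2) ` {k. k < length w \<and> w ! k \<noteq> Up}"

lemma odd_marks_simps [simp]:
  "2 * k + 1 \<in> odd_marks w \<longleftrightarrow> k < length w \<and> w ! k \<noteq> Down"
  "2 * k + 2 \<notin> odd_marks w" "finite (odd_marks w)"
  by (auto simp: odd_marks_def) presburger

lemma even_marks_simps [simp]:
  "2 * k + 2 \<in> even_marks w \<longleftrightarrow> k < length w \<and> w ! k \<noteq> Up"
  "2 * k + 1 \<notin> even_marks w" "finite (even_marks w)"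
  by (auto simp: even_marks_def) presburger

lemma marks_subset: "odd_marks w \<subseteq> {1..2 * length w}" "even_marks w \<subseteq> {1..2 * length w}"
  by (auto simp: odd_marks_def even_marks_def)

lemma marks_disjoint: "odd_marks w \<inter> even_marks w = {}"
  by (auto simp: odd_marks_def even_marks_def) presburger

text \<open>The rise of a step is its number of left ends minus its number of right ends, a
  \<open>Flat\<close> step having one of each. Position 0 is unmarked, so \<open>{..2 * k}\<close>
  sees exactly the first \<open>k\<close> pairs.\<close>

lemma height_take_eq_card_marks:
  assumes "k \<le> length w"
  shows "height (take k w) =
    int (card (odd_marks w \<inter> {..2 * k})) - int (card (even_marks w \<inter> {..2 * k}))"
  using assms
proof (induction k)
  case 0
  have "odd_marks w \<inter> {..0} = {}" "even_marks w \<inter> {..0} = {}"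
    by (auto simp: odd_marks_def even_marks_def)
  then show ?case by (simp add: height_def)
next
  case (Suc k)
  have two: "{..2 * Suc k} = insert (2 * k + 2) (insert (2 * k + 1) {..2 * k})" by auto
  have O: "odd_marks w \<inter> {..2 * Suc k} =
      (if w ! k = Down then {} else {2 * k + 1}) \<union> (odd_marks w \<inter> {..2 * k})"
    using Suc.prems odd_marks_simps(1)[of k w] odd_marks_simps(2)[of k w] unfolding two by auto
  have E: "even_marks w \<inter> {..2 * Suc k} =
      (if w ! k = Up then {} else {2 * k + 2}) \<union> (even_marks w \<inter> {..2 * k})"
    using Suc.prems even_marks_simps(1)[of k w] even_marks_simps(2)[of k w] unfolding two by auto
  have "height (take (Suc k) w) = height (take k w) + rise (w ! k)"
    using Suc.prems by (simp add: height_def take_Suc_conv_app_nth)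
  then show ?case
    using Suc unfolding O E by (cases "w ! k") auto
qed

text \<open>Heights express the ballot condition only at even bounds up to \<open>2 * n\<close>.
  Beyond that it follows from equality of the totals, and an odd bound reduces to the even one below
  it.\<close>

lemma motzkin_paths_iff_ballot:
  "w \<in> motzkin_paths n \<longleftrightarrow> length w = n \<and> card (odd_marks w) = card (even_marks w) \<and>
     (\<forall>i. card (even_marks w \<inter> {..i}) \<le> card (odd_marks w \<inter> {..i}))"
proof (cases "length w = n")
  case True
  have restr: "odd_marks w \<inter> {..i} = odd_marks w" "even_marks w \<inter> {..i} = even_marks w"
    if "2 * n \<le> i" for i
    using marks_subset[of w] that True by force+
  have "height w = int (card (odd_marks w)) - int (card (even_marks w))"
    using height_take_eq_card_marks[of n w] restr[of "2 * n"] True by simp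
  moreover have "(\<forall>k\<le>n. 0 \<le> height (take k w)) \<longleftrightarrow>
      (\<forall>i. card (even_marks w \<inter> {..i}) \<le> card (odd_marks w \<inter> {..i}))"
    (is "?L \<longleftrightarrow> ?R") if eq: "card (odd_marks w) = card (even_marks w)"
  proof
    assume L: ?L
    show ?R
    proof
      fix i
      show "card (even_marks w \<inter> {..i}) \<le> card (odd_marks w \<inter> {..i})"
      proof (cases "2 * n \<le> i")
        case True
        then show ?thesis using restr eq by simp
      next
        case False
        define k where "k = i div 2"
        have k: "k \<le> n" "2 * k \<le> i" "i \<le> 2 * k + 1"
          using False by (auto simp: k_def)
        \<comment> \<open>Passing from \<open>2 * k\<close> to \<open>2 * k + 1\<close> adds no even
          mark; it can only add an odd one, which helps the inequality.\<close>
        have "even_marks w \<inter> {..i} \<subseteq> even_marks w \<inter> {..2 * k}"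
          using k(2,3) unfolding even_marks_def by (intro subsetI) (clarsimp, presburger)
        then have "card (even_marks w \<inter> {..i}) \<le> card (even_marks w \<inter> {..2 * k})"
          by (intro card_mono) auto
        also have "\<dots> \<le> card (odd_marks w \<inter> {..2 * k})"
          using L k height_take_eq_card_marks[of k w] True by auto
        also have "\<dots> \<le> card (odd_marks w \<inter> {..i})"
          using k by (intro card_mono) auto
        finally show ?thesis .
      qed
    qed
  next
    assume ?R
    then show ?L using height_take_eq_card_marks[of _ w] True by auto
  qed
  ultimately show ?thesis
    using True by (auto simp: motzkin_paths_def)
qed (simp add: motzkin_paths_def)

section \<open>The bijection with Motzkin paths\<close>

definition step_word :: "nat \<Rightarrow> (nat \<Rightarrow> nat) \<Rightarrow> step list" where
  "step_word n \<pi> = map (\<lambda>k. if 2 * k + 1 \<notin> openers \<pi> then Down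
     else if 2 * k + 2 \<notin> closers \<pi> then Up else Flat) [0..<n]"

text \<open>\<open>step_word\<close> assigns a word to every map, whatever its pairs look like.
  Reverse alternation amounts to the word losing no information: its marks give back the left and
  right ends.\<close>

lemma RAI_avoiding_4321_iff:
  "\<pi> \<in> RAI_avoiding (2 * n) 4 (one_line [4, 3, 2, 1]) \<longleftrightarrow>
    \<pi> permutes {1..2 * n} \<and> (\<forall>i. \<pi> (\<pi> i) = i) \<and> strict_mono_on (openers \<pi>) \<pi> \<and>
    openers \<pi> = odd_marks (step_word n \<pi>) \<and> closers \<pi> = even_marks (step_word n \<pi>)"
proof (cases "\<pi> permutes {1..2 * n} \<and> (\<forall>i. \<pi> (\<pi> i) = i) \<and> strict_mono_on (openers \<pi>) \<pi>")
  case True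
  have pairs: "X = Y \<longleftrightarrow>
      (\<forall>k<n. (2 * k + 1 \<in> X \<longleftrightarrow> 2 * k + 1 \<in> Y) \<and> (2 * k + 2 \<in> X \<longleftrightarrow> 2 * k + 2 \<in> Y))"
    if sub: "X \<subseteq> {1..2 * n}" "Y \<subseteq> {1..2 * n}" for X Y :: "nat set"
  proof
    assume R: "\<forall>k<n. (2 * k + 1 \<in> X \<longleftrightarrow> 2 * k + 1 \<in> Y) \<and> (2 * k + 2 \<in> X \<longleftrightarrow> 2 * k + 2 \<in> Y)"
    have "i \<in> X \<longleftrightarrow> i \<in> Y" if "i \<in> {1..2 * n}" for i
    proof -
      have "\<exists>k<n. i = 2 * k + 1 \<or> i = 2 * k + 2"
        \<comment> \<open>Positions count from 1 and pairs from 0, hence the shift by one before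
          halving.\<close>
        using that by (intro exI[of _ "(i - 1) div 2"]) auto
      then show ?thesis using R by blast
    qed
    then show "X = Y" using sub by blast
  qed simp
  have marks:
    "2 * k + 1 \<in> odd_marks (step_word n \<pi>) \<longleftrightarrow> 2 * k + 1 \<in> openers \<pi>"
    "2 * k + 2 \<in> even_marks (step_word n \<pi>) \<longleftrightarrow> 2 * k + 1 \<notin> openers \<pi> \<or> 2 * k + 2 \<in> closers \<pi>"
    if "k < n" for k
    unfolding odd_marks_simps even_marks_simps using that by (auto simp: step_word_def)
  have sub: "odd_marks (step_word n \<pi>) \<subseteq> {1..2 * n}" "even_marks (step_word n \<pi>) \<subseteq> {1..2 * n}"
    using marks_subset[of "step_word n \<pi>"] by (simp_all add: step_word_def)
  have perm: "\<pi> permutes {1..2 * n}" and invol: "\<And>i. \<pi> (\<pi> i) = i"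
    and mono: "strict_mono_on (openers \<pi>) \<pi>"
    using True by blast+
  note ends = permutes_openers_closers_subset[OF perm]
  \<comment> \<open>Compared pair by pair, the first equation only forbids left ends at even
    positions. The second forbids right ends at odd positions and requires a right end at
    \<open>2 * k + 2\<close> when \<open>2 * k + 1\<close> is not a left end.\<close>
  have "reverse_alternating (2 * n) \<pi> \<longleftrightarrow>
      openers \<pi> = odd_marks (step_word n \<pi>) \<and> closers \<pi> = even_marks (step_word n \<pi>)"
    unfolding nonnesting_reverse_alternating_iff[OF perm invol mono]
      pairs[OF ends(1) sub(1)] pairs[OF ends(2) sub(2)]
    using marks odd_marks_simps(2) even_marks_simps(2) by blast
  then show ?thesis
    using True involution_avoids_4321_iff[of \<pi> "2 * n"] by (auto simp: RAI_avoiding_def RAI_iff)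
next
  case False
  then show ?thesis
    using involution_avoids_4321_iff[of \<pi> "2 * n"] by (auto simp: RAI_avoiding_def RAI_iff)
qed

lemma step_word_eqI:
  assumes "length w = n" "openers \<pi> = odd_marks w" "closers \<pi> = even_marks w"
  shows "step_word n \<pi> = w"
proof (rule nth_equalityI)
  fix k assume "k < length (step_word n \<pi>)"
  then have "k < n" by (simp add: step_word_def)
  then show "step_word n \<pi> ! k = w ! k"
    using assms odd_marks_simps(1)[of k w] even_marks_simps(1)[of k w]
    by (cases "w ! k") (auto simp: step_word_def)
qed (use assms in \<open>simp add: step_word_def\<close>)

theorem theorem5p2:
  fixes n :: nat
  shows "card (RAI_avoiding (2 * n) 4 (one_line [4, 3, 2, 1])) = motzkin n"
proof -
  let ?R = "RAI_avoiding (2 * n) 4 (one_line [4, 3, 2, 1])"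
  \<comment> \<open>The word fixes both sets of ends through its marks, and these fix the
    involution.\<close>
  have "inj_on (step_word n) ?R"
    by (rule inj_onI) (metis RAI_avoiding_4321_iff nonnesting_involution_unique)
  moreover have "step_word n ` ?R = motzkin_paths n"
  proof (intro subset_antisym subsetI)
    fix w assume "w \<in> step_word n ` ?R"
    then obtain \<pi> where \<pi>: "\<pi> \<in> ?R" "w = step_word n \<pi>" by blast
    then have "\<And>i. \<pi> (\<pi> i) = i" "openers \<pi> = odd_marks w" "closers \<pi> = even_marks w"
      using RAI_avoiding_4321_iff by blast+
    moreover have "length w = n"
      using \<pi>(2) by (simp add: step_word_def)
    ultimately show "w \<in> motzkin_paths n"
      using involution_ballot[of \<pi>] involution_card_closers[of \<pi>] odd_marks_simps(3)[of w]
      by (simp add: motzkin_paths_iff_ballot)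
  next
    fix w assume "w \<in> motzkin_paths n"
    then have w: "length w = n" "card (odd_marks w) = card (even_marks w)"
      "\<And>i. card (even_marks w \<inter> {..i}) \<le> card (odd_marks w \<inter> {..i})"
      by (auto simp: motzkin_paths_iff_ballot)
    \<comment> \<open>The path conditions, in ballot form, are exactly what allows the marks of
      \<open>w\<close> to be joined by nonnesting arcs.\<close>
    obtain \<pi> where \<pi>: "\<pi> permutes odd_marks w \<union> even_marks w" "\<And>i. \<pi> (\<pi> i) = i"
      "openers \<pi> = odd_marks w" "closers \<pi> = even_marks w" "strict_mono_on (odd_marks w) \<pi>"
      using ex_nonnesting_involution[of "odd_marks w" "even_marks w"] w marks_disjoint by auto
    have "step_word n \<pi> = w"
      using step_word_eqI w(1) \<pi>(3,4) by blast
    moreover have "\<pi> permutes {1..2 * n}"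
      using permutes_subset[OF \<pi>(1)] marks_subset[of w] w(1) by simp
    ultimately have "\<pi> \<in> ?R"
      unfolding RAI_avoiding_4321_iff using \<pi> by simp
    then show "w \<in> step_word n ` ?R"
      using \<open>step_word n \<pi> = w\<close> by blast
  qed
  ultimately show ?thesis
    unfolding motzkin_def by (metis card_image)
qed

end
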